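(* Let $m\in\mathbb{N}$, let $X$ stand for $l^G_\infty$ or $c^G$, and let $$U_2=\Big\{a=(a_k)\in\omega(G):\ \sup_k e^{k^{-m}}\odot|a_k|^G<\infty\Big\}.$$ Then $\left[X(\Delta^m_G)\right]^{\alpha\alpha}=U_2$.
   Context: Geometric arithmetic: the map $z\mapsto e^z$ is used as a generator, i.e. it is treated as a bijection from $\mathbb{C}$ onto the set of geometric complex numbers $\mathbb{C}(G)=\{e^z:z\in\mathbb{C}\}$, with inverse $\ln$. Operations: $x\oplus y=e^{\ln x+\ln y}=xy$, $x\ominus y=e^{\ln x-\ln y}=x/y$, $x\odot y=e^{\ln x\cdot\ln y}$; the geometric zero is $1$ and the identity is $e$. Geometric modulus: $|e^z|^G=e^{|z|}\in[1,\infty)$, compared in the usual order of the reals. ${}_G\sum_{k=1}^\infty x_k$ is the geometric limit of the partial sums $x_1\oplus\cdots\oplus x_n$; for real terms $x_k\ge1$, "$<\infty$" means these (increasing) partial sums are bounded. $\mathbb{N}=\{1,2,\dots\}$. $\omega(G)$ is the set of all sequences $x=(x_k)_{k\ge1}$ in $\mathbb{C}(G)$. Set $l_\infty^G=\{x\in\omega(G):\sup_k|x_k|^G<\infty\}$, $c^G=\{x\in\omega(G):|x_k\ominus l|^G\to1\text{ for some }l\in\mathbb{C}(G)\}$. Differences: $\Delta^0_Gx=x$, $\Delta_G^mx=(\Delta^m_Gx_k)_k$ with $\Delta^m_Gx_k=\Delta^{m-1}_Gx_k\ominus\Delta^{m-1}_Gx_{k+1}$. For $X\in\{l_\infty^G,c^G\}$,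 $X(\Delta^m_G)=\{x\in\omega(G):\Delta^m_Gx\in X\}$. $\alpha$-dual: for $Y\subseteq\omega(G)$, $Y^\alpha=\{a=(a_k)\in\omega(G):{}_G\sum_{k=1}^\infty|a_k\odot x_k|^G<\infty\text{ for each }x\in Y\}$, and $Y^{\alpha\alpha}=(Y^\alpha)^\alpha$. *)

theory Defs
  imports Complex_Main
begin

text \<open>
  The complex exponential is not injective, but in geometric arithmetic \<open>z \<mapsto> e\<^sup>z\<close> is
  treated as a bijection from the complex numbers onto the geometric complex numbers. The
  latter therefore form a separate type, whose elements are the formal exponentials \<open>gexp z\<close>
  with logarithm \<open>gln\<close>.
\<close>

datatype gcomplex = gexp (gln: complex)

definition gminus :: "gcomplex \<Rightarrow> gcomplex \<Rightarrow> gcomplex"  (infixl "\<ominus>\<^sub>G" 65) where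
  "x \<ominus>\<^sub>G y = gexp (gln x - gln y)"

definition gtimes :: "gcomplex \<Rightarrow> gcomplex \<Rightarrow> gcomplex"  (infixl "\<odot>\<^sub>G" 70) where
  "x \<odot>\<^sub>G y = gexp (gln x * gln y)"

text \<open>Moduli are genuine real numbers in \<open>[1, \<infinity>)\<close>.\<close>

definition gmod :: "gcomplex \<Rightarrow> real" where
  "gmod x = exp (cmod (gln x))"

text \<open>
  On the reals, \<open>exp\<close> is injective with range the positive reals, so the geometric
  operations on real quantities are defined on \<^typ>\<open>real\<close> itself. They are meaningful for
  positive arguments only.
\<close>

definition rgplus :: "real \<Rightarrow> real \<Rightarrow> real"  (infixl "\<oplus>\<^sub>R" 65) where
  "x \<oplus>\<^sub>R y = exp (ln x + ln y)"

definition rgtimes :: "real \<Rightarrow> real \<Rightarrow> real"  (infixl "\<odot>\<^sub>R" 70) where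
  "x \<odot>\<^sub>R y = exp (ln x * ln y)"

text \<open>The partial sums \<open>t\<^sub>1 \<oplus> \<dots> \<oplus> t\<^sub>n\<close>; the empty one is the geometric zero \<open>1\<close>.\<close>

primrec gpartial_sum :: "(nat \<Rightarrow> real) \<Rightarrow> nat \<Rightarrow> real" where
  "gpartial_sum t 0 = 1"
| "gpartial_sum t (Suc n) = gpartial_sum t n \<oplus>\<^sub>R t (Suc n)"

text \<open>For terms \<open>t\<^sub>k \<ge> 1\<close> the partial sums increase, and a finite sum means they are bounded.\<close>

definition gsum_finite :: "(nat \<Rightarrow> real) \<Rightarrow> bool" where
  "gsum_finite t \<longleftrightarrow> bdd_above (range (gpartial_sum t))"

text \<open>
  Sequences are indexed by \<open>k \<ge> 1\<close>. They are represented by functions on all of \<^typ>\<open>nat\<close>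
  whose value at \<open>0\<close> is irrelevant: membership in any of the sets below does not depend on it.
\<close>

type_synonym gseq = "nat \<Rightarrow> gcomplex"

definition linf_G :: "gseq set" where
  "linf_G = {x. bdd_above ((\<lambda>k. gmod (x k)) ` {1..})}"

definition c_G :: "gseq set" where
  "c_G = {x. \<exists>l. (\<lambda>k. gmod (x k \<ominus>\<^sub>G l)) \<longlonglongrightarrow> 1}"

primrec gdiff :: "nat \<Rightarrow> gseq \<Rightarrow> gseq" where
  "gdiff 0 x = x"
| "gdiff (Suc m) x = (\<lambda>k. gdiff m x k \<ominus>\<^sub>G gdiff m x (Suc k))"

definition diff_space :: "gseq set \<Rightarrow> nat \<Rightarrow> gseq set" where
  "diff_space X m = {x. gdiff m x \<in> X}"

definition alpha_dual :: "gseq set \<Rightarrow> gseq set" where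
  "alpha_dual Y = {a. \<forall>x\<in>Y. gsum_finite (\<lambda>k. gmod (a k \<odot>\<^sub>G x k))}"

definition U2 :: "nat \<Rightarrow> gseq set" where
  "U2 m = {a. bdd_above ((\<lambda>k. exp (real k powi (- int m)) \<odot>\<^sub>R gmod (a k)) ` {1..})}"

end

theory Submission imports Defs
begin

text \<open>
  In logarithmic coordinates the claim is classical. Sequences with bounded \<open>m\<close>-th differences grow
  at most like \<open>k\<^sup>m\<close>, and \<open>k \<mapsto> (k + m choose m)\<close> has constant \<open>m\<close>-th difference while growing at
  least like \<open>k\<^sup>m\<close>. Hence for both choices of \<open>X\<close> the first dual is the \<open>\<ell>\<^sup>1\<close> space with weight
  \<open>k\<^sup>m\<close>, whose own dual is the \<open>\<ell>\<^sup>\<infinity>\<close> space with weight \<open>k\<^sup>-\<^sup>m\<close>.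
\<close>

section \<open>Translation into logarithmic coordinates\<close>

lemma bdd_above_exp_image_iff:
  fixes f :: "'a \<Rightarrow> real"
  shows "bdd_above ((\<lambda>k. exp (f k)) ` A) \<longleftrightarrow> bdd_above (f ` A)"
proof
  assume "bdd_above ((\<lambda>k. exp (f k)) ` A)"
  then obtain M where "\<And>k. k \<in> A \<Longrightarrow> exp (f k) \<le> M"
    by (auto simp: bdd_above_def)
  then have "f k \<le> ln M" if "k \<in> A" for k
    using that by (metis exp_gt_zero ln_exp ln_mono)
  then show "bdd_above (f ` A)"
    by (auto simp: bdd_above_def)
next
  assume "bdd_above (f ` A)"
  then obtain M where "\<And>k. k \<in> A \<Longrightarrow> f k \<le> M"
    by (auto simp: bdd_above_def)
  then have "exp (f k) \<le> exp M" if "k \<in> A" for k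
    using that by simp
  then show "bdd_above ((\<lambda>k. exp (f k)) ` A)"
    by (auto simp: bdd_above_def)
qed

lemma gpartial_sum_exp: "gpartial_sum (\<lambda>k. exp (f k)) n = exp (\<Sum>k<n. f (Suc k))"
  by (induction n) (simp_all add: rgplus_def)

text \<open>For nonnegative terms, bounded partial sums and convergence are the same thing.
  Geometric sums start at index 1 while \<open>summable\<close> starts at 0; one extra term does not
  affect convergence.\<close>

lemma gsum_finite_exp_iff:
  assumes "\<And>k. 0 \<le> f k"
  shows "gsum_finite (\<lambda>k. exp (f k)) \<longleftrightarrow> summable f"
proof -
  have "gsum_finite (\<lambda>k. exp (f k)) \<longleftrightarrow> bdd_above (range (\<lambda>n. \<Sum>k<n. f (Suc k)))"
    unfolding gsum_finite_def by (simp add: gpartial_sum_exp[abs_def] bdd_above_exp_image_iff)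
  also have "\<dots> \<longleftrightarrow> summable (\<lambda>k. f (Suc k))"
  proof
    assume "bdd_above (range (\<lambda>n. \<Sum>k<n. f (Suc k)))"
    then obtain M where "(\<Sum>k<n. f (Suc k)) \<le> M" for n
      by (auto simp: bdd_above_def)
    then show "summable (\<lambda>k. f (Suc k))"
      using assms by (intro summableI_nonneg_bounded)
  next
    assume "summable (\<lambda>k. f (Suc k))"
    then have "(\<Sum>k<n. f (Suc k)) \<le> (\<Sum>k. f (Suc k))" for n
      using assms by (intro sum_le_suminf) auto
    then show "bdd_above (range (\<lambda>n. \<Sum>k<n. f (Suc k)))"
      by (auto simp: bdd_above_def)
  qed
  finally show ?thesis
    by (simp add: summable_Suc_iff)
qed

lemma mem_alpha_dual_iff:
  "a \<in> alpha_dual Y \<longleftrightarrow> (\<forall>x\<in>Y. summable (\<lambda>k. cmod (gln (a k)) * cmod (gln (x k))))"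
  unfolding alpha_dual_def
  by (simp add: gmod_def gtimes_def norm_mult gsum_finite_exp_iff)

lemma mem_linf_G_iff: "x \<in> linf_G \<longleftrightarrow> (\<exists>C. \<forall>k\<ge>1. cmod (gln (x k)) \<le> C)"
  unfolding linf_G_def gmod_def bdd_above_exp_image_iff
  by (auto simp: bdd_above_def)

lemma mem_U2_iff: "a \<in> U2 m \<longleftrightarrow> (\<exists>C. \<forall>k\<ge>1. cmod (gln (a k)) \<le> C * real k ^ m)"
proof -
  have "a \<in> U2 m \<longleftrightarrow> (\<exists>C. \<forall>k\<ge>1. real k powi (- int m) * cmod (gln (a k)) \<le> C)"
    unfolding U2_def gmod_def rgtimes_def bdd_above_exp_image_iff
    by (auto simp: bdd_above_def)
  also have "\<dots> \<longleftrightarrow> (\<exists>C. \<forall>k\<ge>1. cmod (gln (a k)) \<le> C * real k ^ m)"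
    by (intro arg_cong[of _ _ Ex] ext all_cong1 imp_cong refl)
      (simp add: power_int_minus field_simps)
  finally show ?thesis .
qed

lemma c_G_subset_linf_G: "c_G \<subseteq> linf_G"
proof
  fix x assume "x \<in> c_G"
  then obtain l where "(\<lambda>k. exp (cmod (gln (x k) - gln l))) \<longlonglongrightarrow> 1"
    by (auto simp: c_G_def gmod_def gminus_def)
  then have "(\<lambda>k. cmod (gln (x k) - gln l)) \<longlonglongrightarrow> 0"
    by (auto dest: tendsto_ln)
  then have "(\<lambda>k. gln (x k)) \<longlonglongrightarrow> gln l"
    by (simp add: LIM_zero_iff tendsto_norm_zero_iff)
  then have "Bseq (\<lambda>k. gln (x k))"
    by (intro convergent_imp_Bseq convergentI)
  then show "x \<in> linf_G"
    by (auto simp: mem_linf_G_iff Bseq_def)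
qed

section \<open>Growth of sequences with controlled differences\<close>

text \<open>Discrete integration raises the exponent by one. The constant
  \<open>norm (y 1) + C\<close> covers both the initial value and the increments, which lets the
  induction close.\<close>

lemma growth_of_difference_bound:
  fixes y :: "nat \<Rightarrow> 'a::real_normed_vector"
  assumes "\<And>k. k \<ge> 1 \<Longrightarrow> norm (y k - y (Suc k)) \<le> C * real k ^ p"
    and "k \<ge> 1"
  shows "norm (y k) \<le> (norm (y 1) + C) * real k ^ Suc p"
  using \<open>k \<ge> 1\<close>
proof (induction k rule: dec_induct)
  case base
  have "0 \<le> C"
    using order_trans[OF norm_ge_zero assms(1)[of 1]] by simp
  then show ?case by simp
next
  case (step k)
  have C: "0 \<le> C"
    using order_trans[OF norm_ge_zero assms(1)[of 1]] by simp
  have "norm (y (Suc k)) \<le> norm (y k) + norm (y k - y (Suc k))"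
    using norm_triangle_ineq4[of "y k" "y k - y (Suc k)"] by simp
  also have "\<dots> \<le> (norm (y 1) + C) * real k ^ Suc p + C * real k ^ p"
    using step assms(1)[of k] by (intro add_mono) auto
  \<comment> \<open>Enlarging the second constant to match the first lets the powers combine as
    k^(p+1) + k^p = (k+1) k^p.\<close>
  also have "\<dots> \<le> (norm (y 1) + C) * real k ^ Suc p + (norm (y 1) + C) * real k ^ p"
    by (intro add_left_mono mult_right_mono) auto
  also have "\<dots> = (norm (y 1) + C) * (real (Suc k) * real k ^ p)"
    by (simp add: algebra_simps)
  also have "\<dots> \<le> (norm (y 1) + C) * (real (Suc k) * real (Suc k) ^ p)"
    using C by (intro mult_left_mono power_mono) auto
  finally show ?case by simp
qed

text \<open>Each difference undone costs one power of k. The exponent \<open>p\<close> is general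
  only for the induction; the application takes p = 0, that is, bounded m-th differences.\<close>

lemma growth_of_gdiff_bound:
  assumes "\<exists>C. \<forall>k\<ge>1. cmod (gln (gdiff m x k)) \<le> C * real k ^ p"
  shows "\<exists>C. \<forall>k\<ge>1. cmod (gln (x k)) \<le> C * real k ^ (m + p)"
  using assms
proof (induction m arbitrary: p)
  case 0
  then show ?case by simp
next
  case (Suc m)
  then obtain C where
    C: "\<And>k. k \<ge> 1 \<Longrightarrow> cmod (gln (gdiff m x k) - gln (gdiff m x (Suc k))) \<le> C * real k ^ p"
    by (auto simp: gminus_def)
  have "\<exists>D. \<forall>k\<ge>1. cmod (gln (gdiff m x k)) \<le> D * real k ^ Suc p"
    using growth_of_difference_bound[of "\<lambda>k. gln (gdiff m x k)", OF C] by blast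
  from Suc.IH[OF this] show ?case by simp
qed

text \<open>Pascal's rule: each difference lowers the bottom index by one, and the sign flips
  because the later term is the one subtracted.\<close>

lemma gdiff_binomial:
  assumes "j \<le> m"
  shows "gdiff j (\<lambda>k. gexp (of_nat (k + m choose m))) k =
    gexp ((-1) ^ j * of_nat (k + m choose (m - j)))"
  using assms
proof (induction j arbitrary: k)
  case 0
  then show ?case by simp
next
  case (Suc j)
  \<comment> \<open>Writing the bottom index as a successor exposes the form in which Pascal's
    recursion applies.\<close>
  then obtain r where r: "m - j = Suc r" "m - Suc j = r"
    by (metis Suc_diff_Suc Suc_le_eq)
  from Suc show ?case
    by (simp add: r gminus_def algebra_simps)
qed

text \<open>Provides the test sequence that forces the weight k^m in the first dual.\<close>

lemma binomial_sequence_mem_diff_space: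
  "(\<lambda>k. gexp (of_nat (k + m choose m))) \<in> diff_space c_G m"
proof -
  have "gdiff m (\<lambda>k. gexp (of_nat (k + m choose m))) = (\<lambda>_. gexp ((-1) ^ m))"
    by (rule ext) (simp add: gdiff_binomial)
  moreover have "(\<lambda>_. z) \<in> c_G" for z
    unfolding c_G_def by (auto simp: gmod_def gminus_def intro!: exI[of _ z])
  ultimately show ?thesis
    by (simp add: diff_space_def)
qed

lemma power_le_binomial:
  assumes "m \<ge> 1"
  shows "real k ^ m \<le> real m ^ m * real (k + m choose m)"
proof -
  have "(real k / real m) ^ m \<le> (real (k + m) / real m) ^ m"
    by (intro power_mono divide_right_mono) auto
  also have "\<dots> \<le> real (k + m choose m)"
    using binomial_ge_n_over_k_pow_k[of m "k + m", where 'a = real] by simp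
  finally show ?thesis
    using assms by (simp add: power_divide field_simps)
qed

section \<open>The two duals\<close>

text \<open>The sandwich hypothesis treats both choices of \<open>X\<close> at once: the test
  sequence already lies in the smaller space, and the growth bound holds throughout the larger
  one.\<close>

lemma alpha_dual_diff_space:
  assumes "m \<ge> 1" and "c_G \<subseteq> X" and "X \<subseteq> linf_G"
  shows "alpha_dual (diff_space X m) = {a. summable (\<lambda>k. cmod (gln (a k)) * real k ^ m)}"
proof (intro set_eqI iffI CollectI; (elim CollectE)?)
  fix a
  assume "a \<in> alpha_dual (diff_space X m)"
  moreover have "(\<lambda>k. gexp (of_nat (k + m choose m))) \<in> diff_space X m"
    using binomial_sequence_mem_diff_space assms(2) by (auto simp: diff_space_def)
  ultimately have "summable (\<lambda>k. cmod (gln (a k)) * real (k + m choose m))"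
    by (force simp: mem_alpha_dual_iff)
  then have "summable (\<lambda>k. real m ^ m * (cmod (gln (a k)) * real (k + m choose m)))"
    by (rule summable_mult)
  then show "summable (\<lambda>k. cmod (gln (a k)) * real k ^ m)"
  proof (rule summable_comparison_test'[where N = 0])
    fix k
    show "norm (cmod (gln (a k)) * real k ^ m) \<le>
        real m ^ m * (cmod (gln (a k)) * real (k + m choose m))"
      using mult_left_mono[OF power_le_binomial[OF assms(1), of k], of "cmod (gln (a k))"]
      by (simp add: algebra_simps)
  qed
next
  fix a
  assume a: "summable (\<lambda>k. cmod (gln (a k)) * real k ^ m)"
  show "a \<in> alpha_dual (diff_space X m)"
    unfolding mem_alpha_dual_iff
  proof
    fix x assume "x \<in> diff_space X m"
    then have "gdiff m x \<in> linf_G"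
      using assms(3) by (auto simp: diff_space_def)
    then obtain C where C: "\<And>k. k \<ge> 1 \<Longrightarrow> cmod (gln (x k)) \<le> C * real k ^ m"
      using growth_of_gdiff_bound[of m x 0] by (auto simp: mem_linf_G_iff)
    show "summable (\<lambda>k. cmod (gln (a k)) * cmod (gln (x k)))"
    \<comment> \<open>The growth bound says nothing about the arbitrary value at index 0, so the
      comparison starts at 1.\<close>
    proof (rule summable_comparison_test'[where N = 1])
      show "summable (\<lambda>k. C * (cmod (gln (a k)) * real k ^ m))"
        using a by (rule summable_mult)
      show "norm (cmod (gln (a k)) * cmod (gln (x k))) \<le> C * (cmod (gln (a k)) * real k ^ m)"
        if "k \<ge> 1" for k
        using mult_left_mono[OF C[OF that], of "cmod (gln (a k))"] by (simp add: algebra_simps)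
    qed
  qed
qed

text \<open>Gliding hump: if \<open>c\<close> were unbounded, weights 2^-j placed at indices where
  \<open>c\<close> exceeds 2^j would be summable, yet the products would not tend to 0.\<close>

lemma bounded_if_summable_products:
  fixes c :: "nat \<Rightarrow> real"
  assumes "\<And>u. (\<And>k. 0 \<le> u k) \<Longrightarrow> summable u \<Longrightarrow> summable (\<lambda>k. u k * c k)"
  shows "\<exists>C. \<forall>k. c k \<le> C"
proof (rule ccontr)
  assume "\<nexists>C. \<forall>k. c k \<le> C"
  then have unbounded: "\<exists>k. c k > C" for C
    by (meson not_le)
  \<comment> \<open>Exceeding the maximum over the finite initial segment pushes the index past
    \<open>n\<close>, so the indices can be chosen strictly increasing.\<close>
  have "\<exists>k. k > n \<and> c k > C" for n C
  proof -
    obtain k where k: "c k > max C (Max (c ` {..n}))"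
      using unbounded by blast
    have "c i \<le> Max (c ` {..n})" if "i \<le> n" for i
      using that by (intro Max_ge) auto
    with k have "\<not> k \<le> n"
      by force
    with k show ?thesis by auto
  qed
  then obtain g where g: "\<And>j. c (g j) > 2 ^ j" "\<And>j. g (Suc j) > g j"
    using dependent_nat_choice[of "\<lambda>j k. c k > 2 ^ j" "\<lambda>_ k k'. k' > k"] by blast
  then have mono: "strict_mono g"
    by (simp add: strict_mono_Suc_iff)
  then have inj: "inj g"
    by (rule strict_mono_imp_inj_on)
  define u where "u k = (if k \<in> range g then (1 / 2 :: real) ^ inv g k else 0)" for k
  have u: "u (g j) = (1 / 2) ^ j" for j
    by (simp add: u_def inj)
  have "summable (\<lambda>j. u (g j))"
    by (simp add: u summable_geometric)
  \<comment> \<open>Since \<open>u\<close> vanishes off the range of \<open>g\<close>, summing along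
    \<open>g\<close> loses nothing.\<close>
  then have "summable u"
    using summable_mono_reindex[OF mono, of u] by (simp add: u_def)
  moreover have "0 \<le> u k" for k
    by (simp add: u_def)
  ultimately have "summable (\<lambda>k. u k * c k)"
    by (rule assms[rotated])
  then have "summable (\<lambda>j. u (g j) * c (g j))"
    using summable_mono_reindex[OF mono, of "\<lambda>k. u k * c k"] by (simp add: u_def)
  then have "(\<lambda>j. u (g j) * c (g j)) \<longlonglongrightarrow> 0"
    by (rule summable_LIMSEQ_zero)
  moreover have "1 \<le> u (g j) * c (g j)" for j
    using g(1)[of j] by (simp add: u field_simps)
  ultimately have "1 \<le> (0 :: real)"
    by (intro LIMSEQ_le_const) auto
  then show False by simp
qed

text \<open>Moving the weight from one factor to the other reduces this to the duality between
  summable and bounded sequences.\<close>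

lemma alpha_dual_weighted_l1:
  "alpha_dual {a. summable (\<lambda>k. cmod (gln (a k)) * real k ^ m)} = U2 m"
proof (intro set_eqI iffI)
  fix b
  assume b: "b \<in> alpha_dual {a. summable (\<lambda>k. cmod (gln (a k)) * real k ^ m)}"
  have "\<exists>C. \<forall>k. cmod (gln (b k)) / real k ^ m \<le> C"
  proof (rule bounded_if_summable_products)
    fix u :: "nat \<Rightarrow> real"
    assume u: "\<And>k. 0 \<le> u k" "summable u"
    \<comment> \<open>Dividing by the weight makes the weighted modulus of \<open>a\<close> equal to
      \<open>u\<close> for k >= 1. At k = 0 the weight may vanish and the quotient is then 0 by
      convention, so the comparison below starts at 1.\<close>
    define a where "a k = gexp (of_real (u k / real k ^ m))" for k
    have a: "cmod (gln (a k)) = u k / real k ^ m" for k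
      using u(1)[of k] by (simp add: a_def norm_divide norm_power)
    have "summable (\<lambda>k. cmod (gln (a k)) * real k ^ m)"
      by (rule summable_comparison_test'[OF u(2), where N = 1]) (simp add: a u(1))
    with b have "summable (\<lambda>k. cmod (gln (b k)) * cmod (gln (a k)))"
      by (simp add: mem_alpha_dual_iff)
    then show "summable (\<lambda>k. u k * (cmod (gln (b k)) / real k ^ m))"
      by (simp add: a mult.commute)
  qed
  then obtain C where "\<And>k. cmod (gln (b k)) / real k ^ m \<le> C"
    by blast
  then have "cmod (gln (b k)) \<le> C * real k ^ m" if "k \<ge> 1" for k
    using that by (simp add: divide_le_eq split: if_splits)
  then show "b \<in> U2 m"
    by (auto simp: mem_U2_iff)
next
  fix b
  assume "b \<in> U2 m"
  then obtain C where C: "\<And>k. k \<ge> 1 \<Longrightarrow> cmod (gln (b k)) \<le> C * real k ^ m"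
    by (auto simp: mem_U2_iff)
  show "b \<in> alpha_dual {a. summable (\<lambda>k. cmod (gln (a k)) * real k ^ m)}"
    unfolding mem_alpha_dual_iff
  proof safe
    fix a
    assume a: "summable (\<lambda>k. cmod (gln (a k)) * real k ^ m)"
    show "summable (\<lambda>k. cmod (gln (b k)) * cmod (gln (a k)))"
    proof (rule summable_comparison_test'[where N = 1])
      show "summable (\<lambda>k. C * (cmod (gln (a k)) * real k ^ m))"
        using a by (rule summable_mult)
      show "norm (cmod (gln (b k)) * cmod (gln (a k))) \<le> C * (cmod (gln (a k)) * real k ^ m)"
        if "k \<ge> 1" for k
        using mult_right_mono[OF C[OF that], of "cmod (gln (a k))"] by (simp add: algebra_simps)
    qed
  qed
qed

theorem theorem4p6:
  fixes m :: nat and X :: "gseq set"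
  assumes "m \<ge> 1"
    and "X = linf_G \<or> X = c_G"
  shows "alpha_dual (alpha_dual (diff_space X m)) = U2 m"
proof -
  have "c_G \<subseteq> X" and "X \<subseteq> linf_G"
    using assms(2) c_G_subset_linf_G by auto
  then show ?thesis
    using assms(1) by (simp add: alpha_dual_diff_space alpha_dual_weighted_l1)
qed

end
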